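(* Let $\mu>-1/2$ and $c>1$. There is a finite constant $\tau(c,\mu)$ such that for every $f=f_e+f_o\in\mathcal{B}^2_\mu$, $$E_\mu(f)\le c\left\{S_{L^2(\nu_{e,\mu})}(f_e)+S_{L^2(\nu_{o,\mu})}(f_o)\right\}+\tau(c,\mu)\,\|f\|^2_{\mathcal{B}^2_\mu}.$$
   Context: Fix $\mu>-1/2$. For $x>0$ and $\alpha\in\mathbf{R}$, $K_\alpha(x)=\int_0^\infty e^{-x\cosh u}\cosh(\alpha u)\,du$ is the Macdonald function. On $\mathbf{C}$ define the finite measures $d\nu_{e,\mu}(z)=\nu_{e,\mu}(z)\,dx\,dy$ and $d\nu_{o,\mu}(z)=\nu_{o,\mu}(z)\,dx\,dy$ with densities, for $z\neq0$, $$\nu_{e,\mu}(z)=\frac{2^{\frac12-\mu}}{\pi\Gamma(\mu+\frac12)}K_{\mu-\frac12}(|z|^2)|z|^{2\mu+1},\qquad \nu_{o,\mu}(z)=\frac{2^{\frac12-\mu}}{\pi\Gamma(\mu+\frac12)}K_{\mu+\frac12}(|z|^2)|z|^{2\mu+1}.$$ For $f:\mathbf{C}\to\mathbf{C}$, $f_e(z)=(f(z)+f(-z))/2$ and $f_o(z)=(f(z)-f(-z))/2$ are its even and odd parts. $\mathcal{B}^2_\mu$ is the space of entire functions $f$ with $f_e\in L^2(\mathbf{C},\nu_{e,\mu})$ and $f_o\in L^2(\mathbf{C},\nu_{o,\mu})$, with norm $\|f\|^2_{\mathcal{B}^2_\mu}=\|f_e\|^2_{L^2(\nu_{e,\mu})}+\|f_o\|^2_{L^2(\nu_{o,\mu})}$.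 Entropy: for a finite measure space $(\Omega,\nu)$ and $f\in L^2(\Omega,\nu)$, $S_{L^2(\Omega,\nu)}(f)=\int_\Omega|f|^2\log|f|^2\,d\nu-\|f\|^2_{L^2}\log\|f\|^2_{L^2}\in(-\infty,+\infty]$, with $0\log0=0$; here $\Omega=\mathbf{C}$. $\mu$-deformed energy: $E_\mu(f)=\int_{\mathbf{C}}|z|^2|f_e(z)|^2\,d\nu_{e,\mu}(z)+\int_{\mathbf{C}}|z|^2|f_o(z)|^2\,d\nu_{o,\mu}(z)\in[0,+\infty]$ for $f\in\mathcal{B}^2_\mu$. *)

theory Defs
  imports "HOL-Analysis.Analysis"
begin

definition macdonald :: "real \<Rightarrow> real \<Rightarrow> real" where
  "macdonald \<alpha> x = (LBINT u:{0..}. exp (- x * cosh u) * cosh (\<alpha> * u))"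

(* Only z \<noteq> 0 matters: the defining integral of the Macdonald function diverges at 0, where the
   formulas below evaluate to 0; the origin is a null set. *)
definition dens_even :: "real \<Rightarrow> complex \<Rightarrow> real" where
  "dens_even \<mu> z = 2 powr (1/2 - \<mu>) / (pi * Gamma (\<mu> + 1/2))
     * macdonald (\<mu> - 1/2) ((norm z)\<^sup>2) * norm z powr (2 * \<mu> + 1)"

definition dens_odd :: "real \<Rightarrow> complex \<Rightarrow> real" where
  "dens_odd \<mu> z = 2 powr (1/2 - \<mu>) / (pi * Gamma (\<mu> + 1/2))
     * macdonald (\<mu> + 1/2) ((norm z)\<^sup>2) * norm z powr (2 * \<mu> + 1)"

definition nu_even :: "real \<Rightarrow> complex measure" where
  "nu_even \<mu> = density lborel (\<lambda>z. ennreal (dens_even \<mu> z))"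

definition nu_odd :: "real \<Rightarrow> complex measure" where
  "nu_odd \<mu> = density lborel (\<lambda>z. ennreal (dens_odd \<mu> z))"

definition even_part :: "(complex \<Rightarrow> complex) \<Rightarrow> complex \<Rightarrow> complex" where
  "even_part f z = (f z + f (- z)) / 2"

definition odd_part :: "(complex \<Rightarrow> complex) \<Rightarrow> complex \<Rightarrow> complex" where
  "odd_part f z = (f z - f (- z)) / 2"

definition L2 :: "'a measure \<Rightarrow> ('a \<Rightarrow> complex) set" where
  "L2 M = {f \<in> borel_measurable M. integrable M (\<lambda>x. (norm (f x))\<^sup>2)}"

definition L2_norm :: "'a measure \<Rightarrow> ('a \<Rightarrow> complex) \<Rightarrow> real" where
  "L2_norm M f = sqrt (LINT x|M. (norm (f x))\<^sup>2)"

definition Bargmann :: "real \<Rightarrow> (complex \<Rightarrow> complex) set" where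
  "Bargmann \<mu> = {f. f holomorphic_on UNIV
      \<and> even_part f \<in> L2 (nu_even \<mu>) \<and> odd_part f \<in> L2 (nu_odd \<mu>)}"

definition Bargmann_norm :: "real \<Rightarrow> (complex \<Rightarrow> complex) \<Rightarrow> real" where
  "Bargmann_norm \<mu> f =
     sqrt ((L2_norm (nu_even \<mu>) (even_part f))\<^sup>2 + (L2_norm (nu_odd \<mu>) (odd_part f))\<^sup>2)"

(* The integral of |f|^2 log |f|^2 may be +\<infinity>, so it is taken as the integral of the positive part
   minus the integral of the negative part. The latter is finite on a finite measure space, because
   t log t \<ge> -1/e; hence no \<infinity> - \<infinity> arises. The convention 0 log 0 = 0 holds since 0 * ln 0 = 0. *)
definition entropy :: "'a measure \<Rightarrow> ('a \<Rightarrow> complex) \<Rightarrow> ereal" where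
  "entropy M f =
     enn2ereal (\<integral>\<^sup>+ x. ennreal ((norm (f x))\<^sup>2 * ln ((norm (f x))\<^sup>2)) \<partial>M)
     - enn2ereal (\<integral>\<^sup>+ x. ennreal (- ((norm (f x))\<^sup>2 * ln ((norm (f x))\<^sup>2))) \<partial>M)
     - ereal ((L2_norm M f)\<^sup>2 * ln ((L2_norm M f)\<^sup>2))"

definition energy :: "real \<Rightarrow> (complex \<Rightarrow> complex) \<Rightarrow> ennreal" where
  "energy \<mu> f =
     (\<integral>\<^sup>+ z. ennreal ((norm z)\<^sup>2 * (norm (even_part f z))\<^sup>2) \<partial>nu_even \<mu>)
     + (\<integral>\<^sup>+ z. ennreal ((norm z)\<^sup>2 * (norm (odd_part f z))\<^sup>2) \<partial>nu_odd \<mu>)"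

end

theory Submission
  imports Defs "HOL-Probability.Distributions"
begin

text \<open>
  Holomorphy plays no role. On any measure space, the Gibbs variational principle bounds
  \<open>\<integral> (V/c) |f|\<^sup>2\<close> by \<open>S(f) + \<parallel>f\<parallel>\<^sup>2 log \<integral> exp (V/c)\<close>. With \<open>V = |z|\<^sup>2\<close> it remains to see that
  \<open>exp (|z|\<^sup>2/c)\<close> is integrable for both measures when \<open>c > 1\<close>. Writing out the Macdonald
  function and exchanging integrals, the Gaussian integral over \<open>z\<close> is \<open>O(exp (- (\<mu> + 3/2) u))\<close>
  by scaling, which beats \<open>cosh (\<alpha> u)\<close> because \<open>|\<alpha>| < \<mu> + 3/2\<close> for \<open>\<alpha> = \<mu> \<plusminus> 1/2\<close>.
\<close>

section \<open>The Gibbs variational inequality on a measure space\<close>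

text \<open>Young's inequality for the convex conjugates \<open>h ln h - h\<close> and
  \<open>exp v\<close>, with \<open>v\<close> shifted by \<open>ln (N / Z)\<close>. It is
  \<open>ln q \<le> q - 1\<close> multiplied by \<open>h\<close>.\<close>

lemma young_exp_ineq:
  fixes h v N Z :: real
  assumes "h \<ge> 0" "N > 0" "Z > 0"
  shows "h * v \<le> h * ln h - h * ln N + h * ln Z - h + N * exp v / Z"
proof (cases "h = 0")
  case True
  then show ?thesis using assms by simp
next
  case False
  then have h: "h > 0" using assms by simp
  define q where "q = N * exp v / (Z * h)"
  have q: "q > 0" using h assms by (simp add: q_def)
  have "ln q = ln N + v - ln Z - ln h"
    using h assms by (simp add: q_def ln_div ln_mult)
  moreover have "ln q \<le> q - 1" using q by (rule ln_le_minus_one)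
  ultimately have "h * (ln N + v - ln Z - ln h) \<le> h * (q - 1)"
    using h by (intro mult_left_mono) auto
  moreover have "h * q = N * exp v / Z" using h by (simp add: q_def)
  ultimately show ?thesis by (simp add: algebra_simps)
qed

text \<open>Young's inequality is integrated with \<open>h = |f|^2\<close>, \<open>v = V / c\<close>
  and \<open>N\<close> the integral of \<open>h\<close>. The nonnegativity in the last conjunct
  ensures that \<open>ennreal\<close> does not truncate the bound, so that it can be carried back to
  the reals.\<close>

lemma weighted_L2_le_entropy:
  fixes M :: "'a measure" and V :: "'a \<Rightarrow> real"
  assumes f: "f \<in> L2 M" and V[measurable]: "V \<in> borel_measurable M"
    and V0: "\<And>x. V x \<ge> 0" and c: "c > 0" and Z: "Z > 0"
    and Zb: "(\<integral>\<^sup>+x. ennreal (exp (V x / c)) \<partial>M) \<le> ennreal Z"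
  shows "entropy M f = \<infinity> \<or> (\<exists>r. entropy M f = ereal r
    \<and> (\<integral>\<^sup>+x. ennreal (V x * (norm (f x))\<^sup>2) \<partial>M) \<le> ennreal (c * r + c * ln Z * (L2_norm M f)\<^sup>2)
    \<and> 0 \<le> c * r + c * ln Z * (L2_norm M f)\<^sup>2)"
proof -
  define h where "h x = (norm (f x))\<^sup>2" for x
  define N where "N = integral\<^sup>L M h"
  have [measurable]: "f \<in> borel_measurable M" and hint: "integrable M h"
    using f by (auto simp: L2_def h_def[abs_def])
  have [measurable]: "h \<in> borel_measurable M" unfolding h_def by measurable
  have h0: "h x \<ge> 0" for x by (simp add: h_def)
  have N0: "N \<ge> 0" unfolding N_def using h0 by simp
  have L2: "(L2_norm M f)\<^sup>2 = N" using N0 by (simp add: L2_norm_def N_def h_def[abs_def])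
  define A where "A = (\<integral>\<^sup>+x. ennreal (h x * ln (h x)) \<partial>M)"
  define B where "B = (\<integral>\<^sup>+x. ennreal (- (h x * ln (h x))) \<partial>M)"
  have ent: "entropy M f = enn2ereal A - enn2ereal B - ereal (N * ln N)"
    unfolding entropy_def L2 A_def B_def h_def ..
  have eint: "integrable M (\<lambda>x. exp (V x / c))"
    using Zb by (intro integrableI_nonneg) (auto intro: le_less_trans)
  have "B \<le> (\<integral>\<^sup>+x. ennreal (exp (V x / c)) \<partial>M)"
    unfolding B_def
  proof (intro nn_integral_mono ennreal_leI)
    fix x
    show "- (h x * ln (h x)) \<le> exp (V x / c)"
    proof (cases "h x = 0")
      case False
      \<comment> \<open>The choice \<open>v = 0\<close>, \<open>N = Z = 1\<close> reads
        \<open>- h ln h \<le> 1 - h\<close>. Since \<open>1 \<le> exp (V / c)\<close>, the bound by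
        \<open>Z\<close> also controls the negative part of the entropy integral.\<close>
      have "h x * 0 \<le> h x * ln (h x) - h x * ln 1 + h x * ln 1 - h x + 1 * exp 0 / 1"
        by (rule young_exp_ineq) (use h0 in auto)
      moreover have "1 \<le> exp (V x / c)" using V0[of x] c by simp
      ultimately show ?thesis using h0[of x] unfolding exp_zero ln_one by linarith
    qed simp
  qed
  also note Zb
  finally have "B < \<infinity>" by (simp add: le_less_trans)
  then obtain b where b: "B = ennreal b" "b \<ge> 0" by (cases B) auto
  show ?thesis
  proof (cases "A = \<infinity>")
    case True
    then show ?thesis by (simp add: ent b)
  next
    case False
    then obtain a where a: "A = ennreal a" "a \<ge> 0" by (cases A) auto
    have gint: "integrable M (\<lambda>x. h x * ln (h x))"
      unfolding real_integrable_def using a b by (auto simp: A_def B_def)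
    have gval: "(LINT x|M. h x * ln (h x)) = a - b"
      using real_lebesgue_integral_def[OF gint] a b by (simp flip: A_def B_def)
    have er: "entropy M f = ereal (a - b - N * ln N)"
      by (simp add: ent a b enn2ereal_ennreal)
    have main: "(\<integral>\<^sup>+x. ennreal (V x * h x) \<partial>M) \<le> ennreal (c * (a - b - N * ln N) + c * ln Z * N)
      \<and> 0 \<le> c * (a - b - N * ln N) + c * ln Z * N"
    proof (cases "N = 0")
      \<comment> \<open>Young's inequality requires \<open>N > 0\<close>. If \<open>N = 0\<close>,
        then \<open>f\<close> vanishes almost everywhere and both sides are 0.\<close>
      case True
      then have ae: "AE x in M. h x = 0"
        unfolding N_def using integral_nonneg_eq_0_iff_AE[OF hint] h0 by simp
      have "(LINT x|M. h x * ln (h x)) = (LINT x|M. 0)"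
        using ae by (intro integral_cong_AE) (auto elim: eventually_mono)
      moreover have "(\<integral>\<^sup>+x. ennreal (V x * h x) \<partial>M) = (\<integral>\<^sup>+x. 0 \<partial>M)"
        using ae by (intro nn_integral_cong_AE) (auto elim: eventually_mono)
      ultimately show ?thesis using True gval by simp
    next
      case False
      then have Np: "N > 0" using N0 by simp
      \<comment> \<open>An integrable majorant of \<open>V h\<close>: \<open>c\<close> times the
        right-hand side of Young's inequality, the factor clearing the denominator of
        \<open>V / c\<close>.\<close>
      define R where "R x = c * (h x * ln (h x) - h x * ln N + h x * ln Z - h x + N * exp (V x / c) / Z)" for x
      have VR: "V x * h x \<le> R x" for x
        using mult_left_mono[OF young_exp_ineq[OF h0[of x] Np Z, of "V x / c"], of c] c
        by (simp add: R_def mult.commute)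
      have R0: "0 \<le> R x" for x using VR[of x] V0[of x] h0[of x] by (meson mult_nonneg_nonneg order_trans)
      have Rint: "integrable M R"
        unfolding R_def using gint hint eint by (intro integrable_mult_right Bochner_Integration.integrable_add Bochner_Integration.integrable_diff integrable_mult_left integrable_divide) auto
      have "integral\<^sup>L M R = c * ((a - b) - N * ln N + N * ln Z - N + N * (LINT x|M. exp (V x / c)) / Z)"
        unfolding R_def using gint hint eint by (simp add: gval N_def)
      moreover have "(LINT x|M. exp (V x / c)) \<le> Z"
      proof -
        have "ennreal (LINT x|M. exp (V x / c)) \<le> ennreal Z"
          using Zb nn_integral_eq_integral[OF eint] by simp
        then show ?thesis using Z by (simp add: ennreal_le_iff)
      qed
      \<comment> \<open>The exponential term is thus absorbed by the \<open>- N\<close> that comes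
        from integrating \<open>- h\<close>.\<close>
      then have "N * (LINT x|M. exp (V x / c)) / Z \<le> N"
        using Z N0 by (simp add: pos_divide_le_eq mult_left_mono)
      then have "c * ((a - b) - N * ln N + N * ln Z - N + N * (LINT x|M. exp (V x / c)) / Z)
          \<le> c * (a - b - N * ln N + N * ln Z)"
        using c by (intro mult_left_mono) auto
      ultimately have IR: "integral\<^sup>L M R \<le> c * (a - b - N * ln N) + c * ln Z * N"
        by (simp add: algebra_simps)
      have "(\<integral>\<^sup>+x. ennreal (V x * h x) \<partial>M) \<le> (\<integral>\<^sup>+x. ennreal (R x) \<partial>M)"
        by (intro nn_integral_mono ennreal_leI VR)
      also have "\<dots> = ennreal (integral\<^sup>L M R)"
        using Rint R0 by (simp add: nn_integral_eq_integral)
      finally have "(\<integral>\<^sup>+x. ennreal (V x * h x) \<partial>M) \<le> ennreal (integral\<^sup>L M R)" .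
      moreover have "0 \<le> integral\<^sup>L M R"
        using R0 by (rule Bochner_Integration.integral_nonneg)
      ultimately show ?thesis
        using IR by (meson ennreal_leI order_trans)
    qed
    then show ?thesis using er L2 by (auto simp: h_def)
  qed
qed

section \<open>Gaussian integrals over the complex plane\<close>

text \<open>The integrand factors over the real and imaginary coordinates, and each factor is a
  multiple of the normal density of variance \<open>1 / (2 * k)\<close>.\<close>

lemma nn_integral_complex_gaussian_finite:
  fixes k :: real
  assumes k: "k > 0"
  shows "(\<integral>\<^sup>+z. ennreal (exp (- k * (norm (z::complex))\<^sup>2)) \<partial>lborel) < \<infinity>"
proof -
  have "integrable lborel (\<lambda>x. sqrt (pi / k) * normal_density 0 (1 / sqrt (2 * k)) x)"
    using k by (intro integrable_mult_right integrable_normal_density) auto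
  also have "(\<lambda>x. sqrt (pi / k) * normal_density 0 (1 / sqrt (2 * k)) x) = (\<lambda>x. exp (- k * x\<^sup>2))"
    using k by (auto simp: normal_density_def power_divide mult.commute)
  finally have one: "(\<integral>\<^sup>+x. ennreal (exp (- k * x\<^sup>2)) \<partial>lborel) < \<infinity>"
    by (simp add: real_integrable_def top.not_eq_extremum)
  have "(\<integral>\<^sup>+z. ennreal (exp (- k * (norm (z::complex))\<^sup>2)) \<partial>lborel)
     = (\<integral>\<^sup>+z. (\<Prod>b\<in>(Basis::complex set). ennreal (exp (- k * (z \<bullet> b)\<^sup>2))) \<partial>lborel)"
    by (intro nn_integral_cong)
      (simp add: Basis_complex_def cmod_power2 distrib_left flip: ennreal_mult exp_add)
  also have "\<dots> = (\<Prod>b\<in>(Basis::complex set). (\<integral>\<^sup>+x. ennreal (exp (- k * x\<^sup>2)) \<partial>lborel))"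
    by (rule nn_integral_lborel_prod) auto
  also have "\<dots> < \<infinity>" using one by (simp add: Basis_complex_def ennreal_mult_less_top)
  finally show ?thesis .
qed

text \<open>Half of the Gaussian exponent absorbs the power, leaving a Gaussian with parameter
  \<open>k / 2\<close>.\<close>

lemma nn_integral_complex_powr_gaussian_finite:
  fixes k p :: real
  assumes k: "k > 0" and p: "p \<ge> 0"
  shows "(\<integral>\<^sup>+z. ennreal (norm (z::complex) powr p * exp (- k * (norm z)\<^sup>2)) \<partial>lborel) < \<infinity>"
proof -
  \<comment> \<open>From \<open>ln r \<le> r\<close> and, by completing the square,
    \<open>p r \<le> (k/2) r^2 + p^2 / (2k)\<close>.\<close>
  define C where "C = exp (p\<^sup>2 / (2 * k))"
  have bd: "r powr p * exp (- k * r\<^sup>2) \<le> C * exp (- (k / 2) * r\<^sup>2)" if "r \<ge> 0" for r :: real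
  proof (cases "r = 0")
    case False
    then have r: "r > 0" using that by simp
    have "0 \<le> (k * r - p)\<^sup>2 / (2 * k)" using k by simp
    also have "\<dots> = k / 2 * r\<^sup>2 + p\<^sup>2 / (2 * k) - p * r"
      using k by (simp add: field_simps power2_eq_square)
    finally have "p * r \<le> k / 2 * r\<^sup>2 + p\<^sup>2 / (2 * k)" by simp
    moreover have "p * ln r \<le> p * r" using p r ln_le_minus_one[of r] by (intro mult_left_mono) auto
    ultimately have "p * ln r + - k * r\<^sup>2 \<le> p\<^sup>2 / (2 * k) + - (k / 2) * r\<^sup>2"
      by (simp add: algebra_simps)
    then show ?thesis using r by (simp add: C_def powr_def flip: exp_add)
  qed (simp add: C_def)
  have "(\<integral>\<^sup>+z. ennreal (norm (z::complex) powr p * exp (- k * (norm z)\<^sup>2)) \<partial>lborel)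
     \<le> (\<integral>\<^sup>+z. ennreal C * ennreal (exp (- (k / 2) * (norm (z::complex))\<^sup>2)) \<partial>lborel)"
    by (intro nn_integral_mono) (use bd in \<open>simp add: C_def ennreal_leI flip: ennreal_mult\<close>)
  also have "\<dots> = ennreal C * (\<integral>\<^sup>+z. ennreal (exp (- (k / 2) * (norm (z::complex))\<^sup>2)) \<partial>lborel)"
    by (intro nn_integral_cmult) auto
  also have "\<dots> < \<infinity>"
    using nn_integral_complex_gaussian_finite[of "k / 2"] k by (simp add: ennreal_mult_less_top)
  finally show ?thesis .
qed

text \<open>The Jacobian is the square of \<open>t\<close> because the plane has real dimension
  2.\<close>

lemma nn_integral_complex_scale:
  fixes g :: "complex \<Rightarrow> ennreal" and t :: real
  assumes [measurable]: "g \<in> borel_measurable borel" and t: "t > 0"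
  shows "(\<integral>\<^sup>+z. g z \<partial>lborel) = ennreal (t\<^sup>2) * (\<integral>\<^sup>+z. g (t *\<^sub>R z) \<partial>lborel)"
  by (subst lborel_affine[of t 0])
    (use t in \<open>simp_all add: nn_integral_density nn_integral_distr nn_integral_cmult ennreal_power\<close>)

section \<open>Exponential integrability against the Macdonald densities\<close>

text \<open>Only an inequality, since \<^const>\<open>macdonald\<close> is 0 where its integral diverges.\<close>
lemma macdonald_le_nn_integral:
  "ennreal (macdonald \<alpha> x)
    \<le> (\<integral>\<^sup>+u. ennreal (exp (- x * cosh u) * cosh (\<alpha> * u)) * indicator {0..} u \<partial>lborel)"
proof -
  have "ennreal (macdonald \<alpha> x)
      \<le> (\<integral>\<^sup>+u. ennreal (indicat_real {0..} u *\<^sub>R (exp (- x * cosh u) * cosh (\<alpha> * u))) \<partial>lborel)"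
  proof (cases "integrable lborel (\<lambda>u. indicat_real {0..} u *\<^sub>R (exp (- x * cosh u) * cosh (\<alpha> * u)))")
    case True
    then show ?thesis
      unfolding macdonald_def set_lebesgue_integral_def
      by (subst nn_integral_eq_integral) (auto intro!: mult_nonneg_nonneg)
  next
    case False
    then show ?thesis
      unfolding macdonald_def set_lebesgue_integral_def
      by (simp add: not_integrable_integral_eq)
  qed
  also have "\<dots> = (\<integral>\<^sup>+u. ennreal (exp (- x * cosh u) * cosh (\<alpha> * u)) * indicator {0..} u \<partial>lborel)"
    by (intro nn_integral_cong) (simp split: split_indicator)
  finally show ?thesis .
qed

lemma borel_measurable_cosh [measurable]: "(cosh :: real \<Rightarrow> real) \<in> borel_measurable borel"
  by (intro borel_measurable_continuous_onI continuous_intros)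

lemma cosh_le_exp_abs:
  fixes x :: real
  shows "cosh x \<le> exp \<bar>x\<bar>"
proof -
  have "exp x \<le> exp \<bar>x\<bar>" "exp (- x) \<le> exp \<bar>x\<bar>" by auto
  then show ?thesis unfolding cosh_field_def by argo
qed

text \<open>By Tonelli the \<open>z\<close>-integral is done first. For fixed \<open>u\<close> its
  integrand is dominated by a Gaussian with parameter \<open>k * exp u\<close>, and rescaling
  \<open>z\<close> by \<open>exp (- u / 2)\<close> turns this parameter into \<open>k\<close>,
  leaving an explicit exponential in \<open>u\<close>.\<close>

lemma nn_integral_exp_macdonald_finite:
  fixes \<alpha> b p :: real
  assumes b: "0 \<le> b" "b < 1" and p: "p \<ge> 0" and \<alpha>: "\<bar>\<alpha>\<bar> < p / 2 + 1"
  shows "(\<integral>\<^sup>+z. ennreal (macdonald \<alpha> ((norm (z::complex))\<^sup>2)) *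
           ennreal (norm z powr p * exp (b * (norm z)\<^sup>2)) \<partial>lborel) < \<infinity>"
proof -
  \<comment> \<open>Chosen so that \<open>cosh u - b \<ge> (1 - b) cosh u \<ge> k exp u\<close>, by
    \<open>cosh u \<ge> 1\<close> and \<open>cosh u \<ge> exp u / 2\<close>.\<close>
  define k where "k = (1 - b) / 2"
  have k: "k > 0" using b by (simp add: k_def)
  \<comment> \<open>The net decay rate in \<open>u\<close>: 1 from the Jacobian and
    \<open>p / 2\<close> from the power weight, against the growth rate
    \<open>\<bar>\<alpha>\<bar>\<close> of \<open>cosh (\<alpha> * u)\<close>.\<close>
  define s where "s = p / 2 + 1 - \<bar>\<alpha>\<bar>"
  have s: "s > 0" using \<alpha> by (simp add: s_def)
  define C where "C = (\<integral>\<^sup>+z. ennreal (norm (z::complex) powr p * exp (- k * (norm z)\<^sup>2)) \<partial>lborel)"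
  have C: "C < \<infinity>" unfolding C_def by (rule nn_integral_complex_powr_gaussian_finite[OF k p])
  define F where "F z u = ennreal (exp (- (norm z)\<^sup>2 * cosh u) * cosh (\<alpha> * u)) * indicator {0..} u *
           ennreal (norm z powr p * exp (b * (norm z)\<^sup>2))" for z :: complex and u :: real
  have Fm: "case_prod F \<in> borel_measurable (lborel \<Otimes>\<^sub>M lborel)"
    unfolding F_def by measurable
  have "(\<integral>\<^sup>+z. ennreal (macdonald \<alpha> ((norm (z::complex))\<^sup>2)) *
           ennreal (norm z powr p * exp (b * (norm z)\<^sup>2)) \<partial>lborel)
     \<le> (\<integral>\<^sup>+z. (\<integral>\<^sup>+u. F z u \<partial>lborel) \<partial>lborel)"
    unfolding F_def
    by (intro nn_integral_mono, subst nn_integral_multc)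
      (auto intro!: mult_right_mono order_trans[OF macdonald_le_nn_integral])
  also have "\<dots> = (\<integral>\<^sup>+u. (\<integral>\<^sup>+z. F z u \<partial>lborel) \<partial>lborel)"
    by (rule lborel_pair.Fubini'[OF Fm, symmetric])
  also have "\<dots> \<le> (\<integral>\<^sup>+u. C * (ennreal (exp (- s * u)) * indicator {0..} u) \<partial>lborel)"
  proof (intro nn_integral_mono)
    fix u :: real
    show "(\<integral>\<^sup>+z. F z u \<partial>lborel) \<le> C * (ennreal (exp (- s * u)) * indicator {0..} u)"
    proof (cases "u \<ge> 0")
      case u: True
      \<comment> \<open>With this scale \<open>k * exp u * |t z|^2 = k * |z|^2\<close>.\<close>
      define t where "t = exp (- u / 2)"
      have t: "t > 0" "t\<^sup>2 = exp (- u)"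
        by (auto simp: t_def power2_eq_square simp flip: exp_add)
      have key: "k * exp u \<le> cosh u - b"
      proof -
        have "exp u \<le> 2 * cosh u" by (simp add: cosh_field_def)
        then have "k * exp u \<le> k * (2 * cosh u)" using k by (intro mult_left_mono) auto
        also have "\<dots> = cosh u - b * cosh u" by (simp add: k_def field_simps)
        also have "\<dots> \<le> cosh u - b" using b mult_left_mono[OF cosh_real_ge_1[of u] b(1)] by simp
        finally show ?thesis .
      qed
      have "F z u \<le> ennreal (exp (\<bar>\<alpha>\<bar> * u)) * ennreal (norm z powr p * exp (- (k * exp u) * (norm z)\<^sup>2))" for z
      proof -
        have "F z u = ennreal (cosh (\<alpha> * u) * (norm z powr p * exp (- (cosh u - b) * (norm z)\<^sup>2)))"
          using u by (simp add: F_def algebra_simps exp_diff exp_minus divide_inverse flip: ennreal_mult exp_add)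
        moreover have "- (cosh u - b) * (norm z)\<^sup>2 \<le> - (k * exp u) * (norm z)\<^sup>2"
          using key by (intro mult_right_mono) auto
        then have "ennreal (cosh (\<alpha> * u) * (norm z powr p * exp (- (cosh u - b) * (norm z)\<^sup>2)))
            \<le> ennreal (exp (\<bar>\<alpha>\<bar> * u) * (norm z powr p * exp (- (k * exp u) * (norm z)\<^sup>2)))"
          using cosh_le_exp_abs[of "\<alpha> * u"] u
          by (intro ennreal_leI mult_mono) (auto simp: abs_mult)
        ultimately show ?thesis by (simp add: ennreal_mult)
      qed
      then have "(\<integral>\<^sup>+z. F z u \<partial>lborel) \<le>
         (\<integral>\<^sup>+z. ennreal (exp (\<bar>\<alpha>\<bar> * u)) * ennreal (norm (z::complex) powr p * exp (- (k * exp u) * (norm z)\<^sup>2)) \<partial>lborel)"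
        by (intro nn_integral_mono)
      also have "\<dots> = ennreal (exp (\<bar>\<alpha>\<bar> * u)) *
          (\<integral>\<^sup>+z. ennreal (norm (z::complex) powr p * exp (- (k * exp u) * (norm z)\<^sup>2)) \<partial>lborel)"
        by (intro nn_integral_cmult) auto
      also have "(\<integral>\<^sup>+z. ennreal (norm (z::complex) powr p * exp (- (k * exp u) * (norm z)\<^sup>2)) \<partial>lborel)
         = ennreal (t\<^sup>2) * (\<integral>\<^sup>+z. ennreal (t powr p) * ennreal (norm (z::complex) powr p * exp (- k * (norm z)\<^sup>2)) \<partial>lborel)"
        by (subst nn_integral_complex_scale[of _ t])
          (use t in \<open>auto simp: powr_mult power_mult_distrib mult.assoc exp_minus simp flip: ennreal_mult
             intro!: arg_cong2[where f="(*)"] nn_integral_cong\<close>)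
      also have "\<dots> = ennreal (t\<^sup>2) * (ennreal (t powr p) * C)"
        unfolding C_def by (subst nn_integral_cmult) auto
      also have "ennreal (exp (\<bar>\<alpha>\<bar> * u)) * (ennreal (t\<^sup>2) * (ennreal (t powr p) * C))
          = C * ennreal (exp (\<bar>\<alpha>\<bar> * u) * t\<^sup>2 * t powr p)"
        by (simp add: ennreal_mult mult_ac)
      also have "exp (\<bar>\<alpha>\<bar> * u) * t\<^sup>2 * t powr p = exp (- s * u)"
        unfolding t(2) by (simp add: t_def s_def powr_def algebra_simps flip: exp_add)
      finally show ?thesis using u by simp
    qed (simp add: F_def)
  qed
  also have "\<dots> = C * (\<integral>\<^sup>+u. ennreal (exp (- s * u)) * indicator {0..} u \<partial>lborel)"
    by (intro nn_integral_cmult) auto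
  also have "\<dots> < \<infinity>"
  proof -
    have "(\<integral>\<^sup>+u. ennreal (exp (- s * u)) * indicator {0..} u \<partial>lborel) = ennreal (exp (- s * 0) / s)"
      using has_integral_exp_minus_to_infinity[OF s, of 0]
      by (intro nn_integral_has_integral_lebesgue') auto
    then show ?thesis using C by (simp add: ennreal_mult_less_top)
  qed
  finally show ?thesis .
qed

lemma borel_measurable_macdonald [measurable]: "macdonald \<alpha> \<in> borel_measurable borel"
  unfolding macdonald_def set_lebesgue_integral_def by measurable

lemma macdonald_nonneg: "macdonald \<alpha> x \<ge> 0"
  unfolding macdonald_def set_lebesgue_integral_def by (intro Bochner_Integration.integral_nonneg) auto

text \<open>Both measures of the theorem have this form, with \<open>K\<close> their common
  normalizing factor, \<open>p = 2 * \<mu> + 1\<close> and \<open>\<alpha> = \<mu> - 1/2\<close> or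
  \<open>\<alpha> = \<mu> + 1/2\<close>.\<close>

lemma nn_integral_exp_macdonald_density_finite:
  fixes \<alpha> b p K :: real
  assumes b: "0 \<le> b" "b < 1" and p: "p \<ge> 0" and \<alpha>: "\<bar>\<alpha>\<bar> < p / 2 + 1" and K: "K \<ge> 0"
  shows "(\<integral>\<^sup>+z. ennreal (exp (b * (norm (z::complex))\<^sup>2))
     \<partial>density lborel (\<lambda>z. ennreal (K * macdonald \<alpha> ((norm z)\<^sup>2) * norm z powr p))) < \<infinity>"
proof -
  have "(\<integral>\<^sup>+z. ennreal (exp (b * (norm (z::complex))\<^sup>2))
     \<partial>density lborel (\<lambda>z. ennreal (K * macdonald \<alpha> ((norm z)\<^sup>2) * norm z powr p)))
    = (\<integral>\<^sup>+z. ennreal K * (ennreal (macdonald \<alpha> ((norm (z::complex))\<^sup>2)) *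
           ennreal (norm z powr p * exp (b * (norm z)\<^sup>2))) \<partial>lborel)"
    using K by (subst nn_integral_density)
      (auto simp: ennreal_mult macdonald_nonneg mult.assoc intro!: nn_integral_cong)
  also have "\<dots> = ennreal K * (\<integral>\<^sup>+z. ennreal (macdonald \<alpha> ((norm (z::complex))\<^sup>2)) *
           ennreal (norm z powr p * exp (b * (norm z)\<^sup>2)) \<partial>lborel)"
    by (intro nn_integral_cmult) measurable
  also have "\<dots> < \<infinity>"
    using nn_integral_exp_macdonald_finite[OF b p \<alpha>] by (simp add: ennreal_mult_less_top)
  finally show ?thesis .
qed

section \<open>Comparison of energy and entropy\<close>

theorem theorem4p5:
  fixes \<mu> c :: real
  assumes "\<mu> > - 1/2" and "c > 1"
  shows "\<exists>\<tau>::real. \<forall>f \<in> Bargmann \<mu>.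
    enn2ereal (energy \<mu> f)
      \<le> ereal c * (entropy (nu_even \<mu>) (even_part f) + entropy (nu_odd \<mu>) (odd_part f))
        + ereal (\<tau> * (Bargmann_norm \<mu> f)\<^sup>2)"
proof -
  have K: "2 powr (1/2 - \<mu>) / (pi * Gamma (\<mu> + 1/2)) \<ge> 0"
    using assms by (intro divide_nonneg_nonneg mult_nonneg_nonneg less_imp_le[OF Gamma_real_pos]) auto
  define Ie where "Ie = (\<integral>\<^sup>+z. ennreal (exp ((norm z)\<^sup>2 / c)) \<partial>nu_even \<mu>)"
  define Io where "Io = (\<integral>\<^sup>+z. ennreal (exp ((norm z)\<^sup>2 / c)) \<partial>nu_odd \<mu>)"
  \<comment> \<open>Here \<open>c > 1\<close> gives \<open>b = 1 / c < 1\<close>. The lower bound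
    \<open>- (\<mu> + 3/2) < \<mu> - 1/2\<close> is exactly \<open>\<mu> > - 1/2\<close>.\<close>
  have "Ie < \<infinity>"
    unfolding Ie_def nu_even_def dens_even_def
    using nn_integral_exp_macdonald_density_finite[OF _ _ _ _ K, of "1 / c" "2 * \<mu> + 1" "\<mu> - 1/2"] assms
    by (simp add: abs_less_iff field_simps)
  moreover have "Io < \<infinity>"
    unfolding Io_def nu_odd_def dens_odd_def
    using nn_integral_exp_macdonald_density_finite[OF _ _ _ _ K, of "1 / c" "2 * \<mu> + 1" "\<mu> + 1/2"] assms
    by (simp add: abs_less_iff field_simps)
  ultimately obtain ie io where I: "Ie = ennreal ie" "ie \<ge> 0" "Io = ennreal io" "io \<ge> 0"
    by (cases Ie; cases Io) auto
  \<comment> \<open>One bound for both integrals, so that both parts share the constant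
    \<open>c * ln Z\<close>; the summand 1 makes it positive.\<close>
  define Z where "Z = ie + io + 1"
  have Z: "Z > 0" "Ie \<le> ennreal Z" "Io \<le> ennreal Z"
    using I by (auto simp: Z_def intro!: ennreal_leI)
  have c: "c > 0" using assms by simp
  show ?thesis
  proof (intro exI[of _ "c * ln Z"] ballI)
    fix f assume "f \<in> Bargmann \<mu>"
    then have fe: "even_part f \<in> L2 (nu_even \<mu>)" and fo: "odd_part f \<in> L2 (nu_odd \<mu>)"
      by (auto simp: Bargmann_def)
    have bn: "(Bargmann_norm \<mu> f)\<^sup>2 = (L2_norm (nu_even \<mu>) (even_part f))\<^sup>2 + (L2_norm (nu_odd \<mu>) (odd_part f))\<^sup>2"
      by (simp add: Bargmann_norm_def)
    have me: "(\<lambda>z. (norm z)\<^sup>2) \<in> borel_measurable (nu_even \<mu>)"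
      and mo: "(\<lambda>z. (norm z)\<^sup>2) \<in> borel_measurable (nu_odd \<mu>)"
      by (auto simp: nu_even_def nu_odd_def)
    note e = weighted_L2_le_entropy[OF fe me _ c Z(1) Z(2)[unfolded Ie_def], simplified]
    note o = weighted_L2_le_entropy[OF fo mo _ c Z(1) Z(3)[unfolded Io_def], simplified]
    \<comment> \<open>Each entropy is real or \<open>\<infinity>\<close>, so the sum is never
      indeterminate. If it is \<open>\<infinity>\<close>, so is the right-hand side of the
      claim.\<close>
    consider "entropy (nu_even \<mu>) (even_part f) + entropy (nu_odd \<mu>) (odd_part f) = \<infinity>"
      | r s where "entropy (nu_even \<mu>) (even_part f) = ereal r" "entropy (nu_odd \<mu>) (odd_part f) = ereal s"
      using e o by fastforce
    then show "enn2ereal (energy \<mu> f)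
      \<le> ereal c * (entropy (nu_even \<mu>) (even_part f) + entropy (nu_odd \<mu>) (odd_part f))
        + ereal (c * ln Z * (Bargmann_norm \<mu> f)\<^sup>2)"
    proof cases
      case 1
      then show ?thesis unfolding 1 using c by simp
    next
      case 2
      define x where "x = c * r + c * ln Z * (L2_norm (nu_even \<mu>) (even_part f))\<^sup>2"
      define y where "y = c * s + c * ln Z * (L2_norm (nu_odd \<mu>) (odd_part f))\<^sup>2"
      have xy: "0 \<le> x" "0 \<le> y" using e o 2 by (auto simp: x_def y_def)
      have "energy \<mu> f \<le> ennreal x + ennreal y"
        unfolding energy_def using e o 2 by (intro add_mono) (auto simp: x_def y_def)
      also have "\<dots> = ennreal (x + y)" using xy by simp
      finally have "enn2ereal (energy \<mu> f) \<le> enn2ereal (ennreal (x + y))"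
        by (simp add: less_eq_ennreal.rep_eq)
      also have "\<dots> = ereal (x + y)" by (rule enn2ereal_ennreal) (use xy in simp)
      also have "\<dots> = ereal c * (ereal r + ereal s) + ereal (c * ln Z * (Bargmann_norm \<mu> f)\<^sup>2)"
        by (simp add: bn x_def y_def algebra_simps)
      finally show ?thesis using 2 by simp
    qed
  qed
qed

end
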